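(* For problems (P): $\min_x f(x)$ subject to $g(x)\le 0$, with locally Lipschitz continuous $f:\mathbb{R}^n\to\mathbb{R}$ and $g=(g_1,\dots,g_q):\mathbb{R}^n\to\mathbb{R}^q$, and feasible points $\bar x$ of (P), subMFC at $\bar x$ and the cone-continuity property (CCP) at $\bar x$ are independent conditions. That is: there exist an instance of (P) and a feasible point $\bar x$ of it at which subMFC holds but CCP does not hold; and there exist an instance of (P) and a feasible point $\bar x$ of it at which CCP holds but subMFC does not hold.
   Context: Inequalities between vectors are componentwise; sums and multiples of sets are in the Minkowski sense, and an empty sum is $\{0\}$. For a locally Lipschitz $\phi:\mathbb{R}^n\to\mathbb{R}$, $\partial\phi(\bar x)$ is the Clarke subdifferential: $\partial\phi(\bar x)=\{s\in\mathbb{R}^n : s^\top d\le \phi^\circ(\bar x;d)\ \forall d\in\mathbb{R}^n\}$ with $\phi^\circ(\bar x;d)=\limsup_{x\to\bar x,\,h\downarrow 0}\frac{\phi(x+hd)-\phi(x)}{h}$. AKKT sequence for $\bar x$: a sequence $\{(x^k,u^k,\delta^k,\epsilon^k)\}_{k=1}^\infty\subset\mathbb{R}^n\times\mathbb{R}^q\times\mathbb{R}^q\times\mathbb{R}^n$ such that for all $k\in\mathbb{N}$: $\epsilon^k\in\partial f(x^k)+\sum_{j=1}^q u^k_j\partial g_j(x^k)$, $u^k\ge 0$, $g(x^k)\le\delta^k$, $(u^k)^\top(g(x^k)-\delta^k)=0$; and $(x^k,\delta^k,\epsilon^k)\to(\bar x,0,0)$ as $k\to\infty$. Active sets: $I(\bar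 x)=\{j\in\{1,\dots,q\}: g_j(\bar x)=0\}$; for $g(x)\le\delta$, $I(x,\delta)=\{j\in\{1,\dots,q\}: g_j(x)=\delta_j\}$. subMFC (Subset Mangasarian-Fromovitz Condition) holds at a feasible point $\bar x$ if there exists $I\subseteq I(\bar x)$ such that: (i) if $I\neq\emptyset$, then for all $v=(v_j)_{j\in I}\ge 0$, $v\ne 0$, one has $0\notin\sum_{j\in I}v_j\partial g_j(\bar x)$; (ii) there exists an AKKT sequence for $\bar x$ with $I=I(x^k,\delta^k)$ for all $k\in\mathbb{N}$. CCP holds at a feasible point $\bar x$ if the set-valued mapping $K:\mathbb{R}^n\rightrightarrows\mathbb{R}^n$, where $K(x)$ is the union over all $v=(v_j)_{j\in I(\bar x)}\ge 0$ of the sets $\sum_{j\in I(\bar x)}v_j\partial g_j(x)$, is outer semicontinuous at $\bar x$, i.e. $\limsup_{x\to\bar x}K(x)\subset K(\bar x)$, where $\limsup_{x\to\bar x}K(x)=\{\bar z\in\mathbb{R}^n : \exists\{(x^k,z^k)\}_{k=1}^\infty\subset\mathbb{R}^n\times\mathbb{R}^n,\ (x^k,z^k)\to(\bar x,\bar z),\ z^k\in K(x^k)\ \forall k\in\mathbb{N}\}$. *)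

theory Defs
  imports "HOL-Analysis.Analysis" "HOL-Library.Function_Algebras" "HOL-Library.Set_Algebras"
begin

text \<open>
  The dimensions are existentially quantified, so \<open>\<real>\<^sup>n\<close> cannot be a type
  here. It is the carrier of the library topology \<^const>\<open>Euclidean_space\<close>, i.e. the functions
  \<open>nat \<Rightarrow> real\<close> vanishing at all indices \<open>i \<ge> n\<close>. Coordinates and constraints are
  numbered from \<open>0\<close>. Vector addition and the zero vector are the pointwise ones. Functions on
  \<open>\<real>\<^sup>n\<close> are total HOL functions whose values outside the carrier are never used.
\<close>

definition Rn :: "nat \<Rightarrow> (nat \<Rightarrow> real) set" where
  "Rn n = topspace (Euclidean_space n)"

definition scale_vec :: "real \<Rightarrow> (nat \<Rightarrow> real) \<Rightarrow> nat \<Rightarrow> real" where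
  "scale_vec c x = (\<lambda>i. c * x i)"

definition inner_vec :: "nat \<Rightarrow> (nat \<Rightarrow> real) \<Rightarrow> (nat \<Rightarrow> real) \<Rightarrow> real" where
  "inner_vec n x y = (\<Sum>i<n. x i * y i)"

definition loc_Lipschitz :: "nat \<Rightarrow> ((nat \<Rightarrow> real) \<Rightarrow> real) \<Rightarrow> bool" where
  "loc_Lipschitz n \<phi> \<longleftrightarrow>
    (\<forall>x\<in>Rn n. \<exists>U L. openin (Euclidean_space n) U \<and> x \<in> U \<and>
       (\<forall>y\<in>U. \<forall>z\<in>U. \<bar>\<phi> y - \<phi> z\<bar> \<le> L * L2_set (\<lambda>i. y i - z i) {..<n}))"

definition clarke_dirderiv ::
  "nat \<Rightarrow> ((nat \<Rightarrow> real) \<Rightarrow> real) \<Rightarrow> (nat \<Rightarrow> real) \<Rightarrow> (nat \<Rightarrow> real) \<Rightarrow> ereal" where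
  "clarke_dirderiv n \<phi> xb d =
    Limsup (nhdsin (Euclidean_space n) xb \<times>\<^sub>F at_right 0)
      (\<lambda>(x, h). ereal ((\<phi> (x + scale_vec h d) - \<phi> x) / h))"

definition clarke_subdiff ::
  "nat \<Rightarrow> ((nat \<Rightarrow> real) \<Rightarrow> real) \<Rightarrow> (nat \<Rightarrow> real) \<Rightarrow> (nat \<Rightarrow> real) set" where
  "clarke_subdiff n \<phi> xb =
    {s \<in> Rn n. \<forall>d\<in>Rn n. ereal (inner_vec n s d) \<le> clarke_dirderiv n \<phi> xb d}"

text \<open>
  The instance of (P) with data \<open>n\<close>, \<open>q\<close>, \<open>f\<close>, \<open>g\<close>, where \<open>g j\<close> for \<open>j < q\<close> are the
  component functions of the constraint map.
\<close>

definition problem_instance ::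
  "nat \<Rightarrow> nat \<Rightarrow> ((nat \<Rightarrow> real) \<Rightarrow> real) \<Rightarrow> (nat \<Rightarrow> (nat \<Rightarrow> real) \<Rightarrow> real) \<Rightarrow> bool" where
  "problem_instance n q f g \<longleftrightarrow>
    1 \<le> n \<and> 1 \<le> q \<and> loc_Lipschitz n f \<and> (\<forall>j<q. loc_Lipschitz n (g j))"

definition feasible_point ::
  "nat \<Rightarrow> nat \<Rightarrow> (nat \<Rightarrow> (nat \<Rightarrow> real) \<Rightarrow> real) \<Rightarrow> (nat \<Rightarrow> real) \<Rightarrow> bool" where
  "feasible_point n q g x \<longleftrightarrow> x \<in> Rn n \<and> (\<forall>j<q. g j x \<le> 0)"

definition active_set ::
  "nat \<Rightarrow> (nat \<Rightarrow> (nat \<Rightarrow> real) \<Rightarrow> real) \<Rightarrow> (nat \<Rightarrow> real) \<Rightarrow> (nat \<Rightarrow> real) \<Rightarrow> nat set" where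
  "active_set q g x \<delta> = {j. j < q \<and> g j x = \<delta> j}"

text \<open>
  Sums and \<open>+\<close> of sets below are the Minkowski ones of \<^theory>\<open>HOL-Library.Set_Algebras\<close>;
  in particular a sum over the empty index set is \<open>{0}\<close>.
\<close>

definition AKKT_sequence ::
  "nat \<Rightarrow> nat \<Rightarrow> ((nat \<Rightarrow> real) \<Rightarrow> real) \<Rightarrow> (nat \<Rightarrow> (nat \<Rightarrow> real) \<Rightarrow> real) \<Rightarrow> (nat \<Rightarrow> real) \<Rightarrow>
   (nat \<Rightarrow> nat \<Rightarrow> real) \<Rightarrow> (nat \<Rightarrow> nat \<Rightarrow> real) \<Rightarrow> (nat \<Rightarrow> nat \<Rightarrow> real) \<Rightarrow> (nat \<Rightarrow> nat \<Rightarrow> real) \<Rightarrow> bool" where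
  "AKKT_sequence n q f g xb x u \<delta> \<epsilon> \<longleftrightarrow>
    (\<forall>k. x k \<in> Rn n \<and> u k \<in> Rn q \<and> \<delta> k \<in> Rn q \<and> \<epsilon> k \<in> Rn n \<and>
       \<epsilon> k \<in> clarke_subdiff n f (x k)
              + (\<Sum>j<q. scale_vec (u k j) ` clarke_subdiff n (g j) (x k)) \<and>
       (\<forall>j<q. 0 \<le> u k j) \<and>
       (\<forall>j<q. g j (x k) \<le> \<delta> k j) \<and>
       (\<Sum>j<q. u k j * (g j (x k) - \<delta> k j)) = 0) \<and>
    limitin (Euclidean_space n) x xb sequentially \<and>
    limitin (Euclidean_space q) \<delta> 0 sequentially \<and>
    limitin (Euclidean_space n) \<epsilon> 0 sequentially"

definition subMFC ::
  "nat \<Rightarrow> nat \<Rightarrow> ((nat \<Rightarrow> real) \<Rightarrow> real) \<Rightarrow> (nat \<Rightarrow> (nat \<Rightarrow> real) \<Rightarrow> real) \<Rightarrow> (nat \<Rightarrow> real) \<Rightarrow> bool" where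
  "subMFC n q f g xb \<longleftrightarrow>
    (\<exists>I \<subseteq> active_set q g xb 0.
       (I \<noteq> {} \<longrightarrow>
          (\<forall>v :: nat \<Rightarrow> real. (\<forall>j\<in>I. 0 \<le> v j) \<and> (\<exists>j\<in>I. v j \<noteq> 0) \<longrightarrow>
             0 \<notin> (\<Sum>j\<in>I. scale_vec (v j) ` clarke_subdiff n (g j) xb))) \<and>
       (\<exists>x u \<delta> \<epsilon>. AKKT_sequence n q f g xb x u \<delta> \<epsilon> \<and>
          (\<forall>k. I = active_set q g (x k) (\<delta> k))))"

definition CCP_cone ::
  "nat \<Rightarrow> nat \<Rightarrow> (nat \<Rightarrow> (nat \<Rightarrow> real) \<Rightarrow> real) \<Rightarrow> (nat \<Rightarrow> real) \<Rightarrow> (nat \<Rightarrow> real) \<Rightarrow> (nat \<Rightarrow> real) set" where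
  "CCP_cone n q g xb x =
    (\<Union>v \<in> {v :: nat \<Rightarrow> real. \<forall>j\<in>active_set q g xb 0. 0 \<le> v j}.
       \<Sum>j\<in>active_set q g xb 0. scale_vec (v j) ` clarke_subdiff n (g j) x)"

definition outer_limit ::
  "nat \<Rightarrow> ((nat \<Rightarrow> real) \<Rightarrow> (nat \<Rightarrow> real) set) \<Rightarrow> (nat \<Rightarrow> real) \<Rightarrow> (nat \<Rightarrow> real) set" where
  "outer_limit n K xb =
    {zb \<in> Rn n. \<exists>x z. (\<forall>k :: nat. x k \<in> Rn n \<and> z k \<in> Rn n \<and> z k \<in> K (x k)) \<and>
       limitin (Euclidean_space n) x xb sequentially \<and>
       limitin (Euclidean_space n) z zb sequentially}"

definition CCP :: "nat \<Rightarrow> nat \<Rightarrow> (nat \<Rightarrow> (nat \<Rightarrow> real) \<Rightarrow> real) \<Rightarrow> (nat \<Rightarrow> real) \<Rightarrow> bool" where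
  "CCP n q g xb \<longleftrightarrow> outer_limit n (CCP_cone n q g xb) xb \<subseteq> CCP_cone n q g xb xb"

end

theory Submission
  imports Defs
begin

text \<open>
  Dimension one with one constraint suffices. If \<open>f\<close> is constant, taking \<open>u = 0\<close> and
  \<open>\<delta> > 0\<close> gives an AKKT sequence with empty active sets, so subMFC holds whatever \<open>g\<close> is;
  for \<open>g x = x\<^sup>2\<close> the cones \<open>K x\<close> are half-lines for \<open>x \<noteq> 0\<close> but \<open>K 0 = {0}\<close>, so CCP fails.
  Conversely, for \<open>g x = \<bar>x\<bar>\<close> one has \<open>\<partial>g 0 = [-1, 1]\<close>, so \<open>K 0\<close> is the whole line and CCP
  holds trivially. As \<open>0 \<in> \<partial>g 0\<close>, subMFC forces \<open>I = {}\<close>, hence \<open>u = 0\<close> by complementarity, and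
  with \<open>f x = x\<close> then \<open>\<epsilon> = 1\<close> for every member of the AKKT sequence.
\<close>

text \<open>Keeps the dimension \<open>1\<close> from being rewritten to \<open>Suc 0\<close>, so
  that the facts about \<open>Rn 1\<close> and \<open>Euclidean_space 1\<close> still match during
  simplification.\<close>

declare One_nat_def [simp del]

lemma lessThan_one [simp]: "{..<1 :: nat} = {0}"
  by auto

section \<open>The one-dimensional carrier as a copy of the real line\<close>

definition line :: "real \<Rightarrow> nat \<Rightarrow> real" where
  "line a = (\<lambda>i. if i = 0 then a else 0)"

lemma line_at_0 [simp]: "line a 0 = a"
  by (simp add: line_def)

lemma line_0: "line 0 = 0"
  by (auto simp: line_def)

lemma line_eq_iff [simp]: "line a = line b \<longleftrightarrow> a = b"
  by (metis line_at_0)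

lemma line_eq_0_iff [simp]: "line a = 0 \<longleftrightarrow> a = 0" "0 = line a \<longleftrightarrow> a = 0"
  by (metis line_eq_iff line_0)+

lemma scale_vec_line [simp]: "scale_vec c (line a) = line (c * a)"
  by (auto simp: scale_vec_def line_def)

lemma Rn_1: "Rn 1 = range line"
proof
  have "x = line (x 0)" if "\<forall>i\<ge>1. x i = 0" for x
    using that by (auto simp: line_def)
  then show "Rn 1 \<subseteq> range line"
    unfolding Rn_def topspace_Euclidean_space by blast
qed (auto simp: Rn_def topspace_Euclidean_space line_def)

lemma line_in_Rn [simp]: "line a \<in> Rn 1"
  using Rn_1 by auto

lemma zero_in_Rn [simp]: "0 \<in> Rn n"
  by (simp add: Rn_def topspace_Euclidean_space)

lemma openin_Euclidean_1:
  assumes "open S"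
  shows "openin (Euclidean_space 1) {x \<in> Rn 1. x 0 \<in> S}"
proof -
  have "continuous_map (Euclidean_space 1) euclideanreal (\<lambda>x. x 0)"
    unfolding Euclidean_space_def
    by (intro continuous_map_from_subtopology continuous_map_product_projection) simp
  from openin_continuous_map_preimage[OF this, of S] assms show ?thesis
    by (simp add: Rn_def)
qed

text \<open>Convergence in the product topology is componentwise, and on \<open>Rn 1\<close> all
  coordinates except the one at \<open>0\<close> vanish identically.\<close>

lemma limitin_Euclidean_1:
  assumes "\<And>k. x k \<in> Rn 1" "a \<in> Rn 1"
  shows "limitin (Euclidean_space 1) x a F \<longleftrightarrow> ((\<lambda>k. x k 0) \<longlongrightarrow> a 0) F"
proof -
  have z: "y i = 0" if "y \<in> Rn 1" "i \<noteq> 0" for y i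
    using that by (auto simp: Rn_1 line_def)
  have "((\<lambda>k. x k i) \<longlongrightarrow> a i) F" if "i \<noteq> 0" for i
    using z[OF assms(1) that] z[OF assms(2) that] by simp
  then have "(\<forall>i. ((\<lambda>k. x k i) \<longlongrightarrow> a i) F) \<longleftrightarrow> ((\<lambda>k. x k 0) \<longlongrightarrow> a 0) F"
    by metis
  moreover have "\<forall>i\<ge>1. a i = 0" "\<And>k. \<forall>i\<ge>1. x k i = 0"
    using z assms by auto
  ultimately show ?thesis
    unfolding Euclidean_space_def limitin_subtopology limitin_componentwise by simp
qed

lemma eventually_nhdsin_Euclidean_1:
  assumes "eventually P (nhds (a 0))" "a \<in> Rn 1"
  shows "eventually (\<lambda>x. P (x 0)) (nhdsin (Euclidean_space 1) a)"
proof -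
  obtain S where "open S" "a 0 \<in> S" "\<forall>x\<in>S. P x"
    using assms(1) unfolding eventually_nhds by blast
  then show ?thesis
    using openin_Euclidean_1[of S] assms(2)
    by (auto simp: eventually_nhdsin intro!: exI[of _ "{x \<in> Rn 1. x 0 \<in> S}"])
qed

section \<open>Lipschitz continuity and Clarke subdifferentials of C1 functions\<close>

lemma loc_Lipschitz_1:
  assumes "\<And>t. \<exists>e>0. \<exists>L. \<forall>y\<in>ball t e. \<forall>z\<in>ball t e. \<bar>h y - h z\<bar> \<le> L * \<bar>y - z\<bar>"
  shows "loc_Lipschitz 1 (\<lambda>x. h (x 0))"
  unfolding loc_Lipschitz_def
proof
  fix x :: "nat \<Rightarrow> real" assume x: "x \<in> Rn 1"
  obtain e L where e: "e > 0"
    "\<And>y z. y \<in> ball (x 0) e \<Longrightarrow> z \<in> ball (x 0) e \<Longrightarrow> \<bar>h y - h z\<bar> \<le> L * \<bar>y - z\<bar>"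
    using assms[of "x 0"] by blast
  have "openin (Euclidean_space 1) {y \<in> Rn 1. y 0 \<in> ball (x 0) e}"
    by (rule openin_Euclidean_1) simp
  with e x show "\<exists>U L. openin (Euclidean_space 1) U \<and> x \<in> U \<and>
       (\<forall>y\<in>U. \<forall>z\<in>U. \<bar>h (y 0) - h (z 0)\<bar> \<le> L * L2_set (\<lambda>i. y i - z i) {..<1})"
    by (intro exI[of _ "{y \<in> Rn 1. y 0 \<in> ball (x 0) e}"] exI[of _ L])
       (auto simp: L2_set_def)
qed

text \<open>Mean value inequality for \<open>h s - h' t * s\<close>, whose derivative is small near
  \<open>t\<close>. Both points may vary, as they must for Clarke's quotients, whose base point
  moves.\<close>

lemma strict_derivative_bound:
  fixes h :: "real \<Rightarrow> real"
  assumes deriv: "\<And>s. (h has_real_derivative h' s) (at s)"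
    and cont: "isCont h' t" and "e > 0"
  obtains r where "r > 0"
    "\<And>y z. y \<in> ball t r \<Longrightarrow> z \<in> ball t r \<Longrightarrow> \<bar>h y - h z - h' t * (y - z)\<bar> \<le> e * \<bar>y - z\<bar>"
proof -
  obtain r where r: "r > 0" "\<And>s. dist s t < r \<Longrightarrow> dist (h' s) (h' t) < e"
    using cont \<open>e > 0\<close> unfolding continuous_at_eps_delta dist_real_def by blast
  show thesis
  proof (rule that[OF \<open>r > 0\<close>])
    fix y z assume yz: "y \<in> ball t r" "z \<in> ball t r"
    have "norm ((h y - h' t * y) - (h z - h' t * z)) \<le> e * norm (y - z)"
    proof (rule field_differentiable_bound[of "ball t r" _ "\<lambda>s. h' s - h' t"])
      show "((\<lambda>s. h s - h' t * s) has_field_derivative h' s - h' t) (at s within ball t r)" for s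
        by (rule has_field_derivative_at_within)
           (auto intro!: derivative_eq_intros deriv)
      show "norm (h' s - h' t) \<le> e" if "s \<in> ball t r" for s
        using r(2)[of s] that by (simp add: dist_real_def abs_minus_commute)
    qed (use yz in auto)
    then show "\<bar>h y - h z - h' t * (y - z)\<bar> \<le> e * \<bar>y - z\<bar>"
      by (simp add: algebra_simps)
  qed
qed

lemma loc_Lipschitz_C1:
  fixes h :: "real \<Rightarrow> real"
  assumes "\<And>s. (h has_real_derivative h' s) (at s)" "\<And>s. isCont h' s"
  shows "loc_Lipschitz 1 (\<lambda>x. h (x 0))"
proof (rule loc_Lipschitz_1)
  fix t :: real
  obtain r where r: "r > 0" "\<And>y z. y \<in> ball t r \<Longrightarrow> z \<in> ball t r \<Longrightarrow>
      \<bar>h y - h z - h' t * (y - z)\<bar> \<le> 1 * \<bar>y - z\<bar>"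
    by (rule strict_derivative_bound[OF assms zero_less_one]) blast
  \<comment> \<open>The tolerance \<open>1\<close> in the strict derivative bound yields the
    Lipschitz constant by the triangle inequality.\<close>
  have "\<bar>h y - h z\<bar> \<le> (\<bar>h' t\<bar> + 1) * \<bar>y - z\<bar>" if "y \<in> ball t r" "z \<in> ball t r" for y z
    using order_trans[OF abs_triangle_ineq2 r(2)[OF that]]
    by (simp only: abs_mult distrib_right diff_le_eq add.commute)
  with r(1) show "\<exists>e>0. \<exists>L. \<forall>y\<in>ball t e. \<forall>z\<in>ball t e. \<bar>h y - h z\<bar> \<le> L * \<bar>y - z\<bar>"
    by blast
qed

text \<open>By strict differentiability the quotients converge along the product filter, so their
  upper limit is an ordinary limit.\<close>

lemma clarke_dirderiv_C1:
  fixes h :: "real \<Rightarrow> real"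
  assumes deriv: "\<And>s. (h has_real_derivative h' s) (at s)"
    and cont: "isCont h' (x 0)" and x: "x \<in> Rn 1"
  shows "clarke_dirderiv 1 (\<lambda>x. h (x 0)) x d = ereal (h' (x 0) * d 0)"
proof -
  let ?F = "nhdsin (Euclidean_space 1) x \<times>\<^sub>F at_right (0 :: real)"
  let ?q = "\<lambda>(y, s). (h (y 0 + s * d 0) - h (y 0)) / s"
  have "(?q \<longlongrightarrow> h' (x 0) * d 0) ?F"
  proof (rule tendstoI)
    fix e :: real assume "e > 0"
    \<comment> \<open>Adding \<open>1\<close> keeps \<open>D\<close> positive when
      \<open>d 0 = 0\<close> and makes \<open>\<bar>d 0\<bar> < D\<close> strict, which later gives
      a strict bound by \<open>e * s\<close>.\<close>
    define D where "D = \<bar>d 0\<bar> + 1"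
    have D: "D > 0" "\<bar>d 0\<bar> < D" by (auto simp: D_def)
    obtain r where r: "r > 0" "\<And>y z. y \<in> ball (x 0) r \<Longrightarrow> z \<in> ball (x 0) r \<Longrightarrow>
        \<bar>h y - h z - h' (x 0) * (y - z)\<bar> \<le> e / D * \<bar>y - z\<bar>"
      by (rule strict_derivative_bound[OF deriv cont divide_pos_pos[OF \<open>e > 0\<close> D(1)]]) blast
    \<comment> \<open>The radius is split: the base point stays within \<open>r/2\<close> of
      \<open>x 0\<close>, and \<open>s < r / (2 * D)\<close> moves it by less than
      \<open>r/2\<close>, so both points lie in the ball of radius \<open>r\<close>.\<close>
    have "\<forall>\<^sub>F s in nhds (x 0). s \<in> ball (x 0) (r/2)"
      using \<open>r > 0\<close> by (intro eventually_nhds_in_open) auto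
    then have 1: "\<forall>\<^sub>F y in nhdsin (Euclidean_space 1) x. y 0 \<in> ball (x 0) (r/2)"
      using x by (rule eventually_nhdsin_Euclidean_1)
    have 2: "\<forall>\<^sub>F s in at_right (0 :: real). s \<in> {0<..<r / (2 * D)}"
      using \<open>r > 0\<close> D by (intro eventually_at_right_real) auto
    show "\<forall>\<^sub>F p in ?F. dist (?q p) (h' (x 0) * d 0) < e"
    proof (rule eventually_mono[OF eventually_prodI[OF 1 2]])
      fix p :: "(nat \<Rightarrow> real) \<times> real"
      assume p: "fst p 0 \<in> ball (x 0) (r/2) \<and> snd p \<in> {0<..<r / (2 * D)}"
      obtain y s where [simp]: "p = (y, s)" by (cases p)
      have *: "y 0 \<in> ball (x 0) (r/2)" "s \<in> {0<..<r / (2 * D)}"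
        using p by auto
      have s: "s > 0" "s * D < r / 2" using * D by (auto simp: field_simps)
      have "\<bar>s * d 0\<bar> \<le> s * D"
        using s D by (simp add: abs_mult)
      then have "dist (y 0) (y 0 + s * d 0) < r / 2"
        using s by (simp add: dist_real_def)
      then have "y 0 + s * d 0 \<in> ball (x 0) r" "y 0 \<in> ball (x 0) r"
        using *(1) \<open>r > 0\<close> dist_triangle_half_r[of "y 0" "x 0" r "y 0 + s * d 0"]
        by (simp_all add: dist_commute)
      from r(2)[OF this]
      have "\<bar>h (y 0 + s * d 0) - h (y 0) - h' (x 0) * (s * d 0)\<bar> \<le> e / D * \<bar>s * d 0\<bar>"
        by simp
      also have "\<dots> < e * s"
        using D s \<open>e > 0\<close> by (simp add: abs_mult field_simps)
      finally have "\<bar>h (y 0 + s * d 0) - h (y 0) - h' (x 0) * (s * d 0)\<bar> / s < e"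
        using s by (simp add: field_simps)
      moreover have "\<bar>h (y 0 + s * d 0) - h (y 0) - h' (x 0) * (s * d 0)\<bar> / s
        = \<bar>(h (y 0 + s * d 0) - h (y 0)) / s - h' (x 0) * d 0\<bar>"
        using s by (subst abs_div_pos) (auto simp: diff_divide_distrib)
      ultimately show "dist (?q p) (h' (x 0) * d 0) < e"
        by (simp add: dist_real_def)
    qed
  qed
  then have "((\<lambda>p. ereal (?q p)) \<longlongrightarrow> ereal (h' (x 0) * d 0)) ?F"
    by (rule tendsto_ereal)
  \<comment> \<open>A limit determines the \<open>Limsup\<close> only along a nontrivial
    filter.\<close>
  moreover have "nhdsin (Euclidean_space 1) x \<noteq> bot"
    using x by (auto simp: filter_eq_iff eventually_nhdsin Rn_def intro!: exI[of _ "\<lambda>_. False"])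
  then have "?F \<noteq> bot"
    by (simp add: prod_filter_eq_bot)
  ultimately have "Limsup ?F (\<lambda>p. ereal (?q p)) = ereal (h' (x 0) * d 0)"
    by (intro lim_imp_Limsup)
  then show ?thesis
    by (simp add: clarke_dirderiv_def scale_vec_def case_prod_unfold)
qed

text \<open>The directional derivative is linear in \<open>d\<close>, so testing a subgradient with
  \<open>d = 1\<close> and \<open>d = -1\<close> pins it down.\<close>

lemma clarke_subdiff_C1:
  fixes h :: "real \<Rightarrow> real"
  assumes "\<And>s. (h has_real_derivative h' s) (at s)" "isCont h' (x 0)" "x \<in> Rn 1"
  shows "clarke_subdiff 1 (\<lambda>x. h (x 0)) x = {line (h' (x 0))}"
proof -
  have "s = h' (x 0)" if "\<forall>d. s * d \<le> h' (x 0) * d" for s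
    using that[rule_format, of 1] that[rule_format, of "-1"] by simp
  then show ?thesis
    unfolding clarke_subdiff_def clarke_dirderiv_C1[OF assms]
    by (auto simp: Rn_1 inner_vec_def)
qed

section \<open>The absolute value at its kink\<close>

lemma loc_Lipschitz_abs: "loc_Lipschitz 1 (\<lambda>x. \<bar>x 0\<bar>)"
proof (rule loc_Lipschitz_1)
  show "\<exists>e>0. \<exists>L. \<forall>y\<in>ball t e. \<forall>z\<in>ball t e. \<bar>\<bar>y\<bar> - \<bar>z\<bar>\<bar> \<le> L * \<bar>y - z\<bar>" for t :: real
    by (intro exI[of _ "1 :: real"] conjI) (simp_all add: abs_triangle_ineq3)
qed

text \<open>The base point \<open>0\<close> lies in each of its neighbourhoods, and there the
  quotient is \<open>\<bar>d 0\<bar>\<close>, at least \<open>s * d 0\<close>. Hence every supremum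
  in the \<open>Limsup\<close> is large enough.\<close>

lemma clarke_subdiff_abs_0:
  assumes "\<bar>s\<bar> \<le> 1"
  shows "line s \<in> clarke_subdiff 1 (\<lambda>x. \<bar>x 0\<bar>) 0"
proof -
  have "ereal (s * d 0) \<le> clarke_dirderiv 1 (\<lambda>x. \<bar>x 0\<bar>) 0 d" for d
    unfolding clarke_dirderiv_def Limsup_def
  proof (rule INF_greatest)
    fix P assume "P \<in> {P. eventually P (nhdsin (Euclidean_space 1) 0 \<times>\<^sub>F at_right (0 :: real))}"
    then obtain A B where AB: "eventually A (nhdsin (Euclidean_space 1) 0)"
      "eventually B (at_right (0 :: real))" "\<And>x h. A x \<Longrightarrow> B h \<Longrightarrow> P (x, h)"
      by (auto simp: eventually_prod_filter)
    have "A 0"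
      using AB(1) by (auto simp: eventually_nhdsin Rn_def[symmetric])
    obtain h where "h > 0" "B h"
      using eventually_happens[OF eventually_conj[OF AB(2) eventually_at_right_less]] by auto
    with \<open>A 0\<close> AB have "P (0, h)" by blast
    have "s * d 0 \<le> \<bar>s\<bar> * \<bar>d 0\<bar>"
      by (metis abs_ge_self abs_mult)
    also have "\<dots> \<le> \<bar>d 0\<bar>"
      using assms by (simp add: mult_left_le_one_le)
    also have "\<dots> = \<bar>h * d 0\<bar> / h"
      using \<open>h > 0\<close> by (simp add: abs_mult)
    finally show "ereal (s * d 0) \<le>
        (SUP p\<in>Collect P. case p of (x, h) \<Rightarrow> ereal ((\<bar>(x + scale_vec h d) 0\<bar> - \<bar>x 0\<bar>) / h))"
      using \<open>P (0, h)\<close> by (intro SUP_upper2[of "(0, h)"]) (auto simp: scale_vec_def)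
  qed
  then show ?thesis
    by (auto simp: clarke_subdiff_def inner_vec_def)
qed

text \<open>Only an inclusion, since the image is empty for empty \<open>S\<close>.\<close>

lemma scale_vec_zero_image: "scale_vec 0 ` S \<subseteq> {0}"
  by (auto simp: scale_vec_def)

section \<open>The coordinate, square and constant functions\<close>

lemma loc_Lipschitz_coordinate: "loc_Lipschitz 1 (\<lambda>x. x 0)"
  by (rule loc_Lipschitz_C1[of "\<lambda>t. t" "\<lambda>_. 1"]) simp_all

lemma clarke_subdiff_coordinate:
  assumes "x \<in> Rn 1"
  shows "clarke_subdiff 1 (\<lambda>x. x 0) x = {line 1}"
  using clarke_subdiff_C1[of "\<lambda>t. t" "\<lambda>_. 1" x] assms by simp

lemma loc_Lipschitz_square: "loc_Lipschitz 1 (\<lambda>x. (x 0)\<^sup>2)"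
  by (rule loc_Lipschitz_C1) (auto intro!: derivative_eq_intros continuous_intros)

lemma clarke_subdiff_square:
  assumes "x \<in> Rn 1"
  shows "clarke_subdiff 1 (\<lambda>x. (x 0)\<^sup>2) x = {line (2 * x 0)}"
  using assms by (intro clarke_subdiff_C1) (auto intro!: derivative_eq_intros continuous_intros)

lemma loc_Lipschitz_const: "loc_Lipschitz 1 (\<lambda>_. c)"
  by (rule loc_Lipschitz_C1[of "\<lambda>_. c" "\<lambda>_. 0"]) simp_all

lemma clarke_subdiff_const:
  assumes "x \<in> Rn 1"
  shows "clarke_subdiff 1 (\<lambda>x. c) x = {0}"
  using clarke_subdiff_C1[of "\<lambda>t. c" "\<lambda>_. 0" x] assms by (simp add: line_0)

section \<open>First instance: subMFC without CCP\<close>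

lemma subMFC_constant_objective:
  assumes "feasible_point 1 1 g xb" "clarke_subdiff 1 (g 0) xb \<noteq> {}"
  shows "subMFC 1 1 (\<lambda>_. 0) g xb"
proof -
  have xb: "xb \<in> Rn 1" and g: "g 0 xb \<le> 0"
    using assms by (auto simp: feasible_point_def)
  \<comment> \<open>Positive and tending to \<open>0\<close>: the constraint stays strictly slack
    along the constant sequence \<open>xb\<close>.\<close>
  let ?\<delta> = "\<lambda>k. line (1 / real (Suc k))"
  \<comment> \<open>Nonemptiness enters here: an empty subdifferential would make the whole
    Minkowski sum empty, even with multiplier \<open>0\<close>.\<close>
  have img: "scale_vec 0 ` clarke_subdiff 1 (g 0) xb = {0}"
    by (rule subset_singletonD[OF scale_vec_zero_image, THEN disjE]) (use assms(2) in auto)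
  have less: "g 0 xb < 1 / real (Suc k)" for k
    by (rule le_less_trans[OF g]) simp
  have "limitin (Euclidean_space 1) ?\<delta> 0 sequentially"
    using LIMSEQ_inverse_real_of_nat by (simp add: limitin_Euclidean_1 inverse_eq_divide)
  moreover have "limitin (Euclidean_space 1) (\<lambda>_. a) a sequentially" if "a \<in> Rn 1" for a
    using that by (simp flip: Rn_def)
  moreover have "0 \<in> clarke_subdiff 1 (\<lambda>_. 0) xb + {0}"
    using set_plus_intro[of 0 "{0}" 0 "{0}"] xb by (simp add: clarke_subdiff_const)
  ultimately have akkt: "AKKT_sequence 1 1 (\<lambda>_. 0) g xb (\<lambda>_. xb) (\<lambda>_. 0) ?\<delta> (\<lambda>_. 0)"
    using xb less_imp_le[OF less] by (simp add: AKKT_sequence_def img)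
  have act: "active_set 1 g xb (?\<delta> k) = {}" for k
    using less[of k] by (auto simp: active_set_def)
  show ?thesis
    unfolding subMFC_def
  proof (intro exI[of _ "{}"] conjI)
    show "\<exists>x u \<delta> \<epsilon>. AKKT_sequence 1 1 (\<lambda>_. 0) g xb x u \<delta> \<epsilon> \<and> (\<forall>k. {} = active_set 1 g (x k) (\<delta> k))"
      by (intro exI conjI, rule akkt) (simp only: act simp_thms)
  qed simp_all
qed

lemma not_CCP_square: "\<not> CCP 1 1 (\<lambda>_ x. (x 0)\<^sup>2) 0"
proof -
  let ?K = "CCP_cone 1 1 (\<lambda>_ x. (x 0)\<^sup>2) 0"
  let ?x = "\<lambda>k. line (1 / real (Suc k))"
  have act: "active_set 1 (\<lambda>_ x. (x 0)\<^sup>2) 0 0 = {0}"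
    by (auto simp: active_set_def)
  have K: "?K (line a) = (\<Union>v\<in>{v. 0 \<le> v 0}. {line (v (0 :: nat) * (2 * a))})" for a
    unfolding CCP_cone_def act by (simp add: clarke_subdiff_square)
  \<comment> \<open>The slope at \<open>?x k\<close> is \<open>2 / real (Suc k)\<close>; its
    reciprocal serves as multiplier.\<close>
  have "line 1 \<in> ?K (?x k)" for k
    unfolding K by (rule UN_I[of "\<lambda>_. real (Suc k) / 2"]) auto
  moreover have "limitin (Euclidean_space 1) ?x 0 sequentially"
    using LIMSEQ_inverse_real_of_nat by (simp add: limitin_Euclidean_1 inverse_eq_divide)
  moreover have "limitin (Euclidean_space 1) (\<lambda>_. line 1) (line 1) sequentially"
    by (simp flip: Rn_def)
  ultimately have "line 1 \<in> outer_limit 1 ?K 0"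
    unfolding outer_limit_def mem_Collect_eq
    by (intro conjI exI[of _ ?x] exI[of _ "\<lambda>_. line 1"]) auto
  moreover have "line 1 \<notin> ?K 0"
    using K[of 0] by (simp add: line_0)
  ultimately show ?thesis
    unfolding CCP_def by blast
qed

section \<open>Second instance: CCP without subMFC\<close>

lemma CCP_abs: "CCP 1 1 (\<lambda>_ x. \<bar>x 0\<bar>) 0"
proof -
  have act: "active_set 1 (\<lambda>_ x. \<bar>x 0\<bar>) 0 0 = {0}"
    by (auto simp: active_set_def)
  have "line a \<in> CCP_cone 1 1 (\<lambda>_ x. \<bar>x 0\<bar>) 0 0" for a
  proof -
    \<comment> \<open>Uses \<open>a = \<bar>a\<bar> * sgn a\<close>: a nonnegative multiplier times
      a subgradient in [-1, 1].\<close>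
    have "line (sgn a) \<in> clarke_subdiff 1 (\<lambda>x. \<bar>x 0\<bar>) 0"
      by (rule clarke_subdiff_abs_0) (simp add: sgn_if)
    then have "line a \<in> scale_vec \<bar>a\<bar> ` clarke_subdiff 1 (\<lambda>x. \<bar>x 0\<bar>) 0"
      by (rule rev_image_eqI) (simp add: abs_mult_sgn)
    then show ?thesis
      unfolding CCP_cone_def act by (intro UN_I[of "\<lambda>_. \<bar>a\<bar>"]) auto
  qed
  then show ?thesis
    unfolding CCP_def outer_limit_def by (auto simp: Rn_1)
qed

lemma not_subMFC_abs: "\<not> subMFC 1 1 (\<lambda>x. x 0) (\<lambda>_ x. \<bar>x 0\<bar>) 0"
proof
  let ?g = "\<lambda>_ x. \<bar>x 0\<bar>"
  assume "subMFC 1 1 (\<lambda>x. x 0) ?g 0"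
  then obtain I x u \<delta> \<epsilon> where
    mf: "I \<noteq> {} \<longrightarrow> (\<forall>v :: nat \<Rightarrow> real. (\<forall>j\<in>I. 0 \<le> v j) \<and> (\<exists>j\<in>I. v j \<noteq> 0) \<longrightarrow>
             0 \<notin> (\<Sum>j\<in>I. scale_vec (v j) ` clarke_subdiff 1 (?g j) 0))"
    and akkt: "AKKT_sequence 1 1 (\<lambda>x. x 0) ?g 0 x u \<delta> \<epsilon>"
    and I: "I \<subseteq> active_set 1 ?g 0 0" "\<And>k. I = active_set 1 ?g (x k) (\<delta> k)"
    unfolding subMFC_def by blast
  have "line 0 \<in> clarke_subdiff 1 (\<lambda>x. \<bar>x 0\<bar>) 0"
    by (rule clarke_subdiff_abs_0) simp
  then have "0 \<in> scale_vec 1 ` clarke_subdiff 1 (\<lambda>x. \<bar>x 0\<bar>) 0"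
    by (rule rev_image_eqI) simp
  \<comment> \<open>The multiplier \<open>1\<close> on the zero subgradient violates condition (i)
    of subMFC.\<close>
  then have "I \<noteq> {0}"
    using mf[rule_format, of "\<lambda>_. 1"] by auto
  moreover have "I \<subseteq> {0}"
    using I(1) by (auto simp: active_set_def)
  ultimately have "I = {}" by blast
  note seq = akkt[unfolded AKKT_sequence_def, THEN conjunct1]
  have "\<epsilon> k = line 1" for k
  proof -
    \<comment> \<open>Nonzero slack, so the single term of the complementarity sum can vanish only
      if \<open>u k 0 = 0\<close>.\<close>
    have "\<bar>x k 0\<bar> \<noteq> \<delta> k 0"
      using I(2)[of k] \<open>I = {}\<close> by (auto simp: active_set_def)
    moreover have "x k \<in> Rn 1"
      and "(\<Sum>j<1. u k j * (\<bar>x k 0\<bar> - \<delta> k j)) = 0"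
      and "\<epsilon> k \<in> clarke_subdiff 1 (\<lambda>x. x 0) (x k) + (\<Sum>j<1. scale_vec (u k j) ` clarke_subdiff 1 (\<lambda>x. \<bar>x 0\<bar>) (x k))"
      using seq[THEN spec[of _ k]] by blast+
    ultimately have "u k 0 = 0" and "x k \<in> Rn 1" and
      "\<epsilon> k \<in> clarke_subdiff 1 (\<lambda>x. x 0) (x k) + scale_vec (u k 0) ` clarke_subdiff 1 (\<lambda>x. \<bar>x 0\<bar>) (x k)"
      by simp_all
    \<comment> \<open>The zero multiplier leaves only the gradient of the objective.\<close>
    then have "\<epsilon> k \<in> {line 1} + {0}"
      using set_plus_mono2[OF order_refl scale_vec_zero_image]
      by (auto simp: clarke_subdiff_coordinate)
    then show ?thesis
      by (auto elim: set_plus_elim)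
  qed
  then have "limitin (Euclidean_space 1) (\<lambda>_. line 1) 0 sequentially"
    using akkt unfolding AKKT_sequence_def by presburger
  then show False
    by (simp add: limitin_Euclidean_1 LIMSEQ_const_iff)
qed

theorem proposition4p12:
  shows "(\<exists>(n :: nat) (q :: nat) (f :: (nat \<Rightarrow> real) \<Rightarrow> real) (g :: nat \<Rightarrow> (nat \<Rightarrow> real) \<Rightarrow> real) (xb :: nat \<Rightarrow> real).
            problem_instance n q f g \<and> feasible_point n q g xb \<and>
            subMFC n q f g xb \<and> \<not> CCP n q g xb) \<and>
         (\<exists>(n :: nat) (q :: nat) (f :: (nat \<Rightarrow> real) \<Rightarrow> real) (g :: nat \<Rightarrow> (nat \<Rightarrow> real) \<Rightarrow> real) (xb :: nat \<Rightarrow> real).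
            problem_instance n q f g \<and> feasible_point n q g xb \<and>
            CCP n q g xb \<and> \<not> subMFC n q f g xb)"
proof
  have "problem_instance 1 1 (\<lambda>_. 0) (\<lambda>_ x. (x 0)\<^sup>2)"
    by (simp add: problem_instance_def loc_Lipschitz_const loc_Lipschitz_square)
  moreover have feas: "feasible_point 1 1 (\<lambda>_ x. (x 0)\<^sup>2) 0"
    by (simp add: feasible_point_def)
  moreover have "subMFC 1 1 (\<lambda>_. 0) (\<lambda>_ x. (x 0)\<^sup>2) 0"
    using feas by (rule subMFC_constant_objective) (simp add: clarke_subdiff_square)
  ultimately show "\<exists>n q f g xb. problem_instance n q f g \<and> feasible_point n q g xb \<and>
      subMFC n q f g xb \<and> \<not> CCP n q g xb"
    using not_CCP_square by blast
next
  have "problem_instance 1 1 (\<lambda>x. x 0) (\<lambda>_ x. \<bar>x 0\<bar>)"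
    by (simp add: problem_instance_def loc_Lipschitz_coordinate loc_Lipschitz_abs)
  moreover have "feasible_point 1 1 (\<lambda>_ x. \<bar>x 0\<bar>) 0"
    by (simp add: feasible_point_def)
  ultimately show "\<exists>n q f g xb. problem_instance n q f g \<and> feasible_point n q g xb \<and>
      CCP n q g xb \<and> \<not> subMFC n q f g xb"
    using CCP_abs not_subMFC_abs by blast
qed

end
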